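(* Let $G$ be a finite simple undirected graph with at least one edge and maximum degree $\Delta$. Then for every vertex $v_i$ of $G$, with degree $d_i$, $$\mathcal{E}_G(v_i)\ge\sqrt{\frac{d_i}{\Delta}}.$$
   Context: For a finite simple undirected graph $G$ with vertices $v_1,\dots,v_n$ and adjacency matrix $A$, let $|A|=(AA^* )^{1/2}$. The energy of the vertex $v_i$ is $\mathcal{E}_G(v_i)=|A|_{ii}$. $d_i$ is the degree of $v_i$ and $\Delta$ the maximum degree of $G$. *)

theory Defs
  imports "HOL-Analysis.Analysis" "Graph_Theory.Digraph"
begin

text \<open>
  A finite simple undirected graph is a \<^locale>\<open>graph\<close>: a finite, loopfree digraph
  without parallel arcs whose arc relation is symmetric. An undirected edge is thus a pair of
  opposite arcs, so the degree of a vertex is its \<^const>\<open>out_degree\<close> (not the sum of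
  in- and out-degree).
\<close>

definition max_degree :: "('a, 'b) pre_digraph \<Rightarrow> nat" where
  "max_degree G = Max (out_degree G ` verts G)"

text \<open>
  The vertices are enumerated by a bijection \<open>v\<close> from a finite index type onto
  \<^term>\<open>verts G\<close>.
\<close>

definition adjacency_matrix :: "('a, 'b) pre_digraph \<Rightarrow> ('n::finite \<Rightarrow> 'a) \<Rightarrow> real^'n^'n" where
  "adjacency_matrix G v = (\<chi> i j. if v i \<rightarrow>\<^bsub>G\<^esub> v j then 1 else 0)"

definition pos_semidef :: "real^'n^'n \<Rightarrow> bool" where
  "pos_semidef B \<longleftrightarrow> transpose B = B \<and> (\<forall>x. 0 \<le> x \<bullet> (B *v x))"

text \<open>
  A positive semidefinite matrix has exactly one positive semidefinite square root; only on such
  matrices is the following description meaningful.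
\<close>

definition psd_sqrt :: "real^'n^'n \<Rightarrow> real^'n^'n" where
  "psd_sqrt M = (THE B. pos_semidef B \<and> B ** B = M)"

text \<open>All matrices here are real, so the adjoint is the transpose.\<close>

definition matrix_abs :: "real^'n^'n \<Rightarrow> real^'n^'n" where
  "matrix_abs A = psd_sqrt (A ** transpose A)"

definition vertex_energy :: "('a, 'b) pre_digraph \<Rightarrow> ('n::finite \<Rightarrow> 'a) \<Rightarrow> 'n \<Rightarrow> real" where
  "vertex_energy G v i = matrix_abs (adjacency_matrix G v) $ i $ i"

end

theory Submission
  imports Defs
begin

text \<open>
  Let \<open>P = |A|\<close> and let \<open>e\<close> be the unit vector at \<open>v\<^sub>i\<close>. Two applications of Cauchy-Schwarz, one for
  the form of \<open>P\<close> and one for the standard inner product, give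
  \<open>(Pe \<bullet> Pe)\<^sup>3 \<le> (e \<bullet> Pe)\<^sup>2 (P\<^sup>2e \<bullet> P\<^sup>2e)\<close>, where \<open>Pe \<bullet> Pe = d\<^sub>i\<close> and \<open>P\<^sup>2e \<bullet> P\<^sup>2e\<close> is the
  number of closed walks of length 4 at \<open>v\<^sub>i\<close>. The latter is the sum of the squares of the
  codegrees with \<open>v\<^sub>i\<close>; each codegree is at most \<open>d\<^sub>i\<close> and they add up to at most \<open>d\<^sub>i \<Delta>\<close>, so it
  is at most \<open>d\<^sub>i\<^sup>2 \<Delta>\<close>. That \<open>|A|\<close> is well defined follows from the spectral theorem.
\<close>

section \<open>Symmetric operators\<close>

text \<open>The form at \<open>x + t y\<close> is a quadratic in \<open>t\<close> that never goes
  negative, which bounds its discriminant. Nonnegativity is asked only on \<open>S\<close> so that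
  the bound applies to operators restricted to an invariant subspace.\<close>

lemma psd_form_Cauchy_Schwarz:
  fixes f :: "'a::real_inner \<Rightarrow> 'a"
  assumes f: "linear f" and sym: "\<And>x y. x \<bullet> f y = f x \<bullet> y"
    and S: "subspace S" and nonneg: "\<And>x. x \<in> S \<Longrightarrow> 0 \<le> x \<bullet> f x"
    and x: "x \<in> S" and y: "y \<in> S"
  shows "(x \<bullet> f y)\<^sup>2 \<le> (x \<bullet> f x) * (y \<bullet> f y)"
proof -
  have quad: "0 \<le> (y \<bullet> f y) * t\<^sup>2 + 2 * (x \<bullet> f y) * t + (x \<bullet> f x)" for t
  proof -
    have "0 \<le> (x + t *\<^sub>R y) \<bullet> f (x + t *\<^sub>R y)"
      using S x y by (intro nonneg subspace_add subspace_scale)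
    moreover have "y \<bullet> f x = x \<bullet> f y"
      by (metis sym inner_commute)
    ultimately show ?thesis
      by (simp add: linear_add[OF f] linear_scale[OF f] inner_add_left inner_add_right
          power2_eq_square algebra_simps)
  qed
  have y0: "0 \<le> y \<bullet> f y" using nonneg y by blast
  show ?thesis
  proof (cases "y \<bullet> f y = 0")
    case True
    have "x \<bullet> f y = 0"
    proof (rule ccontr)
      assume nz: "x \<bullet> f y \<noteq> 0"
      \<comment> \<open>The quadratic has become affine; this \<open>t\<close> makes its value
        -1.\<close>
      have "0 \<le> 2 * (x \<bullet> f y) * (- (x \<bullet> f x + 1) / (2 * (x \<bullet> f y))) + (x \<bullet> f x)"
        using quad[of "- (x \<bullet> f x + 1) / (2 * (x \<bullet> f y))"] True by simp
      then show False using nz by simp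
    qed
    then show ?thesis using True by simp
  next
    case False
    then have pos: "0 < y \<bullet> f y" using y0 by simp
    \<comment> \<open>Evaluation at the minimum of the quadratic.\<close>
    have "0 \<le> (x \<bullet> f x) - (x \<bullet> f y)\<^sup>2 / (y \<bullet> f y)"
      using quad[of "- (x \<bullet> f y) / (y \<bullet> f y)"] pos
      by (simp add: power2_eq_square field_simps)
    then show ?thesis using pos by (simp add: field_simps)
  qed
qed

text \<open>The Rayleigh quotient attains its maximum \<open>c\<close> on the compact unit sphere of
  \<open>S\<close>. Then \<open>c - f\<close> is nonnegative on \<open>S\<close>, and its form
  vanishes at the maximiser, which therefore lies in its kernel.\<close>

lemma symmetric_eigenvector_in_invariant_subspace:
  fixes f :: "'a::euclidean_space \<Rightarrow> 'a"
  assumes f: "linear f" and sym: "\<And>x y. x \<bullet> f y = f x \<bullet> y"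
    and S: "subspace S" and inv: "\<And>x. x \<in> S \<Longrightarrow> f x \<in> S"
    and nontriv: "a \<in> S" "a \<noteq> 0"
  obtains x c where "x \<in> S" "norm x = 1" "f x = c *\<^sub>R x"
proof -
  have "compact (S \<inter> sphere 0 1)"
    by (simp add: S closed_subspace closed_Int_compact)
  moreover have "(1 / norm a) *\<^sub>R a \<in> S \<inter> sphere 0 1"
    using nontriv S by (simp add: subspace_scale)
  moreover have "continuous_on (S \<inter> sphere 0 1) (\<lambda>x. x \<bullet> f x)"
    by (intro continuous_intros linear_continuous_on f linear_conv_bounded_linear[THEN iffD1])
  ultimately obtain x where x: "x \<in> S" "norm x = 1"
    and max: "\<And>y. y \<in> S \<Longrightarrow> norm y = 1 \<Longrightarrow> y \<bullet> f y \<le> x \<bullet> f x"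
    using continuous_attains_sup[of "S \<inter> sphere 0 1" "\<lambda>x. x \<bullet> f x"]
    by (metis Int_iff empty_iff mem_sphere_0)
  define c where "c = x \<bullet> f x"
  define g where "g y = c *\<^sub>R y - f y" for y
  have g: "linear g"
    unfolding g_def by (intro linear_compose_sub f linear_compose_scale_right linear_id[unfolded id_def])
  have gsym: "y \<bullet> g z = g y \<bullet> z" for y z
    by (simp add: g_def inner_diff_left inner_diff_right sym)
  have nonneg: "0 \<le> y \<bullet> g y" if y: "y \<in> S" for y
  proof (cases "y = 0")
    case False
    have "((1 / norm y) *\<^sub>R y) \<bullet> f ((1 / norm y) *\<^sub>R y) \<le> c"
      unfolding c_def using False y S by (intro max subspace_scale) auto
    then have "y \<bullet> f y \<le> c * (norm y)\<^sup>2"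
      using False by (simp add: linear_scale[OF f] power2_eq_square field_simps)
    then show ?thesis
      by (simp add: g_def inner_diff_right power2_norm_eq_inner)
  qed (simp add: g_def)
  have "x \<bullet> g x = 0"
    using x(2) by (simp add: g_def inner_diff_right c_def norm_eq_1)
  moreover have gx: "g x \<in> S"
    unfolding g_def using x(1) S inv by (intro subspace_diff subspace_scale)
  \<comment> \<open>Cauchy-Schwarz for the form of \<open>g\<close>, applied to the pair
    \<open>g x\<close>, \<open>x\<close>; the factor \<open>x \<bullet> g x\<close> is zero.\<close>
  ultimately have "(g x \<bullet> g x)\<^sup>2 \<le> 0"
    using psd_form_Cauchy_Schwarz[OF g gsym S nonneg gx x(1)] by simp
  then have "g x = 0" by simp
  then have "f x = c *\<^sub>R x" by (simp add: g_def)
  with x that show thesis by blast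
qed

text \<open>A largest orthonormal set of eigenvectors must span: otherwise its orthogonal complement
  is nonzero and invariant under \<open>f\<close>, hence contains a further unit
  eigenvector.\<close>

lemma symmetric_orthonormal_eigenbasis:
  fixes f :: "'a::euclidean_space \<Rightarrow> 'a"
  assumes f: "linear f" and sym: "\<And>x y. x \<bullet> f y = f x \<bullet> y"
  obtains B where "finite B" "pairwise orthogonal B" "\<And>b. b \<in> B \<Longrightarrow> norm b = 1"
    "span B = UNIV" "\<And>b. b \<in> B \<Longrightarrow> f b = (b \<bullet> f b) *\<^sub>R b"
proof -
  \<comment> \<open>For a unit eigenvector \<open>b\<close> the eigenvalue is
    \<open>b \<bullet> f b\<close>, so no separate name for it is needed.\<close>
  define Q where "Q B \<longleftrightarrow> pairwise orthogonal B \<and>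
      (\<forall>b\<in>B. norm b = 1 \<and> f b = (b \<bullet> f b) *\<^sub>R b)" for B
  have bound: "finite B \<and> card B \<le> DIM('a)" if "Q B" for B
  proof -
    have "0 \<notin> B" using that unfolding Q_def by (metis norm_zero zero_neq_one)
    then have "independent B" using that pairwise_orthogonal_independent Q_def by blast
    then show ?thesis by (rule independent_bound)
  qed
  have "Q {}" by (simp add: Q_def)
  then obtain B where B: "Q B" and max: "\<And>C. Q C \<Longrightarrow> card C \<le> card B"
    using ex_has_greatest_nat[of Q "{}" card "Suc DIM('a)"] bound
    by (metis le_imp_less_Suc)
  have "span B = UNIV"
  proof (rule ccontr)
    assume "span B \<noteq> UNIV"
    then obtain a where a: "a \<noteq> 0" "span B \<subseteq> {x. a \<bullet> x = 0}"
      using span_not_univ_subset_hyperplane by blast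
    define S where "S = {x. \<forall>b\<in>B. b \<bullet> x = 0}"
    have S: "subspace S"
      by (auto simp: S_def subspace_def inner_add_right)
    have "a \<in> S"
      using a(2) span_superset[of B] by (auto simp: S_def inner_commute)
    moreover have "f x \<in> S" if "x \<in> S" for x
      unfolding S_def
    proof safe
      fix b assume "b \<in> B"
      then have "f b = (b \<bullet> f b) *\<^sub>R b" "b \<bullet> x = 0"
        using B that by (auto simp: Q_def S_def)
      then show "b \<bullet> f x = 0" by (metis sym inner_scaleR_left mult_zero_right)
    qed
    ultimately obtain x c where x: "x \<in> S" "norm x = 1" "f x = c *\<^sub>R x"
      using symmetric_eigenvector_in_invariant_subspace[OF f sym S] a(1) by metis
    have "x \<notin> B" using x(1,2) by (auto simp: S_def norm_eq_1)
    moreover have "Q (insert x B)"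
      using B x by (auto simp: Q_def S_def pairwise_insert orthogonal_def inner_commute norm_eq_1)
    ultimately show False using max[of "insert x B"] bound[OF B] by simp
  qed
  with B bound that show thesis unfolding Q_def by blast
qed

section \<open>The square root of a positive semidefinite matrix\<close>

lemma pos_semidef_symmetric_operator:
  assumes "pos_semidef B"
  shows "x \<bullet> (B *v y) = (B *v x) \<bullet> y" "0 \<le> x \<bullet> (B *v x)"
proof -
  show "x \<bullet> (B *v y) = (B *v x) \<bullet> y"
    using assms by (metis pos_semidef_def dot_lmul_matrix transpose_matrix_vector)
  show "0 \<le> x \<bullet> (B *v x)"
    using assms by (simp add: pos_semidef_def)
qed

lemma pos_semidef_mult_transpose: "pos_semidef (A ** transpose A)"
  unfolding pos_semidef_def
proof (intro conjI allI)
  show "transpose (A ** transpose A) = A ** transpose A"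
    by (simp add: matrix_transpose_mul transpose_transpose)
  fix x
  \<comment> \<open>Both factors on the right are the same vector, so the form is a squared
    norm.\<close>
  have "x \<bullet> ((A ** transpose A) *v x) = (x v* A) \<bullet> (transpose A *v x)"
    by (metis dot_lmul_matrix matrix_vector_mul_assoc)
  then show "0 \<le> x \<bullet> ((A ** transpose A) *v x)" by simp
qed

text \<open>Factor \<open>P\<^sup>2 - c\<close> as \<open>(P + sqrt c)(P - sqrt c)\<close>: for
  \<open>c > 0\<close> the first factor is injective because \<open>P\<close> has no negative
  eigenvalue. For \<open>c = 0\<close>, the squared norm of \<open>P b\<close> is
  \<open>b \<bullet> P\<^sup>2 b = 0\<close>. This drives the uniqueness of the square root.\<close>

lemma pos_semidef_sqrt_on_eigenvector:
  fixes P :: "real^'n^'n"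
  assumes P: "pos_semidef P" and eig: "(P ** P) *v b = c *\<^sub>R b" and c: "0 \<le> c"
  shows "P *v b = sqrt c *\<^sub>R b"
proof (cases "c = 0")
  case True
  then have "b \<bullet> (P *v (P *v b)) = 0" using eig by (simp add: matrix_vector_mul_assoc)
  then have "(P *v b) \<bullet> (P *v b) = 0" by (simp add: pos_semidef_symmetric_operator(1)[OF P])
  then show ?thesis using True by simp
next
  case False
  define y where "y = P *v b - sqrt c *\<^sub>R b"
  have "P *v y = P *v (P *v b) - sqrt c *\<^sub>R (P *v b)"
    by (simp add: y_def matrix_vector_mult_diff_distrib matrix_vector_mult_scaleR)
  also have "\<dots> = - sqrt c *\<^sub>R y"
    using eig c by (simp add: y_def matrix_vector_mul_assoc scaleR_right_diff_distrib)
  finally have "0 \<le> - sqrt c * (y \<bullet> y)"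
    using pos_semidef_symmetric_operator(2)[OF P, of y] by simp
  moreover have "0 < sqrt c" using False c by simp
  ultimately have "y \<bullet> y \<le> 0"
    by (simp add: mult_le_0_iff)
  then have "y = 0" by (metis inner_ge_zero inner_eq_zero_iff order_antisym)
  then show ?thesis by (simp add: y_def)
qed

lemma matrix_eqI_span:
  fixes M N :: "real^'n^'m"
  assumes "span B = UNIV" "\<And>b. b \<in> B \<Longrightarrow> M *v b = N *v b"
  shows "M = N"
  unfolding matrix_eq
  using linear_eq_on_span[OF matrix_vector_mul_linear matrix_vector_mul_linear, of B M N] assms
  by auto

text \<open>Existence: replace each eigenvalue by its square root in an orthonormal eigenbasis.
  Uniqueness: any two roots agree on that basis by
  \<open>pos_semidef_sqrt_on_eigenvector\<close>.\<close>

lemma psd_sqrt_ex1: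
  fixes M :: "real^'n^'n"
  assumes M: "pos_semidef M"
  shows "\<exists>!P. pos_semidef P \<and> P ** P = M"
proof -
  obtain B where B: "finite B" "pairwise orthogonal B" "\<And>b. b \<in> B \<Longrightarrow> norm b = 1"
    "span B = UNIV" "\<And>b. b \<in> B \<Longrightarrow> M *v b = (b \<bullet> (M *v b)) *\<^sub>R b"
    by (rule symmetric_orthonormal_eigenbasis
        [OF matrix_vector_mul_linear pos_semidef_symmetric_operator(1)[OF M]]) blast
  define l where "l b = b \<bullet> (M *v b)" for b
  have l: "0 \<le> l b" for b
    unfolding l_def by (rule pos_semidef_symmetric_operator(2)[OF M])
  \<comment> \<open>The sum of the orthogonal projections onto the lines of \<open>B\<close>,
    weighted by \<open>sqrt (l b)\<close>.\<close>
  define f where "f x = (\<Sum>b\<in>B. (sqrt (l b) * (b \<bullet> x)) *\<^sub>R b)" for x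
  have f: "linear f"
    by (rule linearI) (simp_all add: f_def inner_add_right scaleR_sum_right algebra_simps sum.distrib)
  define P where "P = matrix f"
  have Pf: "P *v x = f x" for x
    unfolding P_def by (rule matrix_works) (use f in \<open>simp add: linear_def scalar_mult_eq_scaleR\<close>)
  have Pb: "P *v b = sqrt (l b) *\<^sub>R b" if "b \<in> B" for b
  proof -
    have "f b = (\<Sum>c\<in>B. if c = b then sqrt (l b) *\<^sub>R b else 0)"
      unfolding f_def
    proof (rule sum.cong)
      fix c assume "c \<in> B"
      then show "(sqrt (l c) * (c \<bullet> b)) *\<^sub>R c = (if c = b then sqrt (l b) *\<^sub>R b else 0)"
        using B(2,3) that by (auto simp: pairwise_def orthogonal_def norm_eq_1)
    qed simp
    then show ?thesis using B(1) that by (simp add: Pf)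
  qed
  \<comment> \<open>This expression is symmetric in \<open>x\<close> and \<open>y\<close> and a
    weighted sum of squares for \<open>x = y\<close>, which yields both halves of
    \<open>pos_semidef P\<close>.\<close>
  have form: "x \<bullet> (P *v y) = (\<Sum>b\<in>B. sqrt (l b) * ((b \<bullet> x) * (b \<bullet> y)))" for x y
    unfolding Pf f_def inner_sum_right
    by (rule sum.cong) (simp_all add: inner_commute[of x])
  have "(x v* P) \<bullet> y = (P *v x) \<bullet> y" for x y
    unfolding dot_lmul_matrix inner_commute[of "P *v x" y] form
    by (simp add: mult.commute)
  then have "x v* P = P *v x" for x
    by (metis vector_eq_rdot)
  then have "transpose P = P"
    by (simp add: matrix_eq)
  moreover have "0 \<le> x \<bullet> (P *v x)" for x
    unfolding form using l by (intro sum_nonneg) simp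
  ultimately have "pos_semidef P" by (simp add: pos_semidef_def)
  moreover have "P ** P = M"
  proof (rule matrix_eqI_span[OF B(4)])
    fix b assume b: "b \<in> B"
    have "(P ** P) *v b = l b *\<^sub>R b"
      using l[of b] by (simp add: Pb[OF b] matrix_vector_mult_scaleR flip: matrix_vector_mul_assoc)
    then show "(P ** P) *v b = M *v b" using B(5)[OF b] by (simp add: l_def)
  qed
  moreover have "R = P" if R: "pos_semidef R" "R ** R = M" for R
  proof (rule matrix_eqI_span[OF B(4)])
    fix b assume b: "b \<in> B"
    have "(R ** R) *v b = l b *\<^sub>R b" using B(5)[OF b] R(2) by (simp add: l_def)
    then show "R *v b = P *v b"
      using pos_semidef_sqrt_on_eigenvector[OF R(1) _ l] by (simp add: Pb[OF b])
  qed
  ultimately show ?thesis by blast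
qed

text \<open>Existence and uniqueness make the definite description in \<open>psd_sqrt\<close>
  denote; these two facts characterise \<open>|A|\<close>.\<close>

lemma matrix_abs:
  shows pos_semidef_matrix_abs: "pos_semidef (matrix_abs A)"
    and matrix_abs_square: "matrix_abs A ** matrix_abs A = A ** transpose A"
  using theI'[OF psd_sqrt_ex1[OF pos_semidef_mult_transpose[of A]]]
  by (simp_all add: matrix_abs_def psd_sqrt_def)

section \<open>Moments and closed walks\<close>

text \<open>With moments \<open>m_k = x \<bullet> P^k x\<close> this reads
  \<open>m_2^3 \<le> m_1^2 m_4\<close>. It combines \<open>m_2^2 \<le> m_1 m_3\<close> (form of
  \<open>P\<close>) with \<open>m_3^2 \<le> m_2 m_4\<close> (inner product): square the first,
  insert the second, cancel \<open>m_2\<close>.\<close>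

lemma pos_semidef_moment_inequality:
  fixes P :: "real^'n^'n"
  assumes P: "pos_semidef P"
  shows "((P *v x) \<bullet> (P *v x)) ^ 3 \<le> (x \<bullet> (P *v x))\<^sup>2 * ((P *v (P *v x)) \<bullet> (P *v (P *v x)))"
proof -
  define y where "y = P *v x"
  define z where "z = P *v y"
  note sym = pos_semidef_symmetric_operator(1)[OF P]
  note nonneg = pos_semidef_symmetric_operator(2)[OF P]
  have "(x \<bullet> z)\<^sup>2 \<le> (x \<bullet> y) * (y \<bullet> z)"
    using psd_form_Cauchy_Schwarz[OF matrix_vector_mul_linear sym subspace_UNIV nonneg, of x y]
    by (simp add: y_def z_def)
  moreover have "x \<bullet> z = y \<bullet> y" unfolding z_def y_def by (rule sym)
  ultimately have "(y \<bullet> y)\<^sup>2 \<le> (x \<bullet> y) * (y \<bullet> z)" by simp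
  then have "((y \<bullet> y)\<^sup>2)\<^sup>2 \<le> ((x \<bullet> y) * (y \<bullet> z))\<^sup>2"
    by (intro power_mono) auto
  also have "\<dots> \<le> (x \<bullet> y)\<^sup>2 * ((y \<bullet> y) * (z \<bullet> z))"
    unfolding power_mult_distrib by (intro mult_left_mono Cauchy_Schwarz_ineq) auto
  finally have *: "(y \<bullet> y) * (y \<bullet> y) ^ 3 \<le> (y \<bullet> y) * ((x \<bullet> y)\<^sup>2 * (z \<bullet> z))"
    by (simp add: power2_eq_square power3_eq_cube mult_ac)
  have "(y \<bullet> y) ^ 3 \<le> (x \<bullet> y)\<^sup>2 * (z \<bullet> z)"
  proof (cases "y = 0")
    case False
    then have "0 < y \<bullet> y" by simp
    with * show ?thesis by (rule mult_left_le_imp_le)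
  qed simp
  then show ?thesis by (simp add: y_def z_def)
qed

lemma zero_one_mult_transpose_diagonal:
  fixes A :: "real^'n^'n"
  assumes zero_one: "\<And>k j. A $ k $ j \<in> {0, 1}"
  shows "axis i 1 \<bullet> ((A ** transpose A) *v axis i 1) = (\<Sum>j\<in>UNIV. A $ i $ j)"
proof -
  have "(\<Sum>j\<in>UNIV. A $ i $ j * A $ i $ j) = (\<Sum>j\<in>UNIV. A $ i $ j)"
    using zero_one by (intro sum.cong) fastforce+
  then show ?thesis
    by (simp add: matrix_vector_mult_basis column_def inner_axis' matrix_matrix_mult_def
        transpose_def)
qed

text \<open>For an adjacency matrix, \<open>w $ k\<close> is the codegree of \<open>i\<close> and
  \<open>k\<close>. The sum of squares is at most the largest entry, bounded by \<open>d\<close>,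
  times the sum of the entries, bounded by \<open>D * d\<close>.\<close>

lemma closed_walks4_le:
  fixes A :: "real^'n^'n" and i :: 'n
  assumes zero_one: "\<And>k j. A $ k $ j \<in> {0, 1}"
    and col: "\<And>j. (\<Sum>k\<in>UNIV. A $ k $ j) \<le> D"
  defines "d \<equiv> \<Sum>j\<in>UNIV. A $ i $ j"
    and "w \<equiv> (A ** transpose A) *v axis i 1"
  shows "w \<bullet> w \<le> d\<^sup>2 * D"
proof -
  have bnd: "0 \<le> A $ k $ j" "A $ k $ j \<le> 1" for k j
    using zero_one[of k j] by auto
  have w: "w $ k = (\<Sum>j\<in>UNIV. A $ k $ j * A $ i $ j)" for k
    by (simp add: w_def matrix_vector_mult_basis column_def matrix_matrix_mult_def transpose_def)
  have d0: "0 \<le> d" unfolding d_def by (intro sum_nonneg bnd)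
  have w0: "0 \<le> w $ k" for k
    unfolding w by (intro sum_nonneg mult_nonneg_nonneg bnd)
  have wd: "w $ k \<le> d" for k
    unfolding w d_def by (intro sum_mono mult_left_le_one_le bnd)
  \<comment> \<open>Double counting: each one in row \<open>i\<close> contributes the sum of its
    column.\<close>
  have "(\<Sum>k\<in>UNIV. w $ k) = (\<Sum>j\<in>UNIV. (\<Sum>k\<in>UNIV. A $ k $ j) * A $ i $ j)"
    unfolding w by (subst sum.swap) (simp add: sum_distrib_right)
  also have "\<dots> \<le> (\<Sum>j\<in>UNIV. D * A $ i $ j)"
    by (intro sum_mono mult_right_mono col bnd)
  finally have sum: "(\<Sum>k\<in>UNIV. w $ k) \<le> D * d"
    by (simp add: d_def sum_distrib_left)
  have "w \<bullet> w = (\<Sum>k\<in>UNIV. w $ k * w $ k)"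
    by (simp add: inner_vec_def)
  also have "\<dots> \<le> (\<Sum>k\<in>UNIV. d * w $ k)"
    by (intro sum_mono mult_right_mono wd w0)
  also have "\<dots> \<le> d * (D * d)"
    unfolding sum_distrib_left[symmetric] by (intro mult_left_mono sum d0)
  finally show ?thesis by (simp add: power2_eq_square mult_ac)
qed

lemma matrix_abs_diagonal_ge:
  fixes A :: "real^'n^'n"
  assumes zero_one: "\<And>k j. A $ k $ j \<in> {0, 1}"
    and col: "\<And>j. (\<Sum>k\<in>UNIV. A $ k $ j) \<le> D"
  shows "sqrt ((\<Sum>j\<in>UNIV. A $ i $ j) / D) \<le> matrix_abs A $ i $ i"
proof -
  define P where "P = matrix_abs A"
  define e :: "real^'n" where "e = axis i 1"
  define d where "d = (\<Sum>j\<in>UNIV. A $ i $ j)"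
  have P: "pos_semidef P" and PP: "P ** P = A ** transpose A"
    unfolding P_def by (rule pos_semidef_matrix_abs matrix_abs_square)+
  have a: "P $ i $ i = e \<bullet> (P *v e)"
    by (simp add: e_def matrix_vector_mult_basis column_def inner_axis')
  have a0: "0 \<le> P $ i $ i"
    unfolding a by (rule pos_semidef_symmetric_operator(2)[OF P])
  have PPe: "P *v (P *v e) = (A ** transpose A) *v e"
    by (simp add: matrix_vector_mul_assoc PP)
  have "(P *v e) \<bullet> (P *v e) = e \<bullet> (P *v (P *v e))"
    by (rule pos_semidef_symmetric_operator(1)[OF P, symmetric])
  also have "\<dots> = d"
    unfolding PPe unfolding e_def d_def by (rule zero_one_mult_transpose_diagonal[OF zero_one])
  finally have Pe: "(P *v e) \<bullet> (P *v e) = d" .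
  have "d ^ 3 \<le> (P $ i $ i)\<^sup>2 * ((P *v (P *v e)) \<bullet> (P *v (P *v e)))"
    using pos_semidef_moment_inequality[OF P, of e] by (simp add: Pe a)
  also have "\<dots> \<le> (P $ i $ i)\<^sup>2 * (d\<^sup>2 * D)"
    unfolding PPe unfolding e_def d_def
    by (intro mult_left_mono closed_walks4_le zero_one col) auto
  finally have le: "d\<^sup>2 * d \<le> d\<^sup>2 * ((P $ i $ i)\<^sup>2 * D)"
    by (simp add: power2_eq_square power3_eq_cube mult_ac)
  have "d / D \<le> (P $ i $ i)\<^sup>2"
  \<comment> \<open>If \<open>d\<close> or \<open>D\<close> is zero, the quotient is 0, by the
    convention for division by zero in the latter case. Otherwise \<open>d\<^sup>2\<close> cancels
    from \<open>le\<close>.\<close>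
  proof (cases "d = 0 \<or> D = 0")
    case False
    have "0 \<le> (\<Sum>k\<in>UNIV. A $ k $ i)"
      by (intro sum_nonneg) (use zero_one in \<open>metis insertE singletonD order_refl zero_le_one\<close>)
    then have "0 < D" using col[of i] False by linarith
    moreover have "d \<le> (P $ i $ i)\<^sup>2 * D"
      using le by (rule mult_left_le_imp_le) (use False in simp)
    ultimately show ?thesis by (simp add: field_simps)
  qed auto
  then have "sqrt (d / D) \<le> P $ i $ i"
    using a0 by (intro real_le_lsqrt)
  then show ?thesis by (simp add: d_def P_def)
qed

section \<open>From graphs to matrices\<close>

lemma adjacency_matrix_row_sum:
  assumes G: "graph G" and v: "bij_betw v UNIV (verts G)"
  shows "(\<Sum>j\<in>UNIV. adjacency_matrix G v $ i $ j) = real (out_degree G (v i))"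
proof -
  interpret graph G by (rule G)
  have "(\<Sum>j\<in>UNIV. adjacency_matrix G v $ i $ j) = real (card {j. v i \<rightarrow>\<^bsub>G\<^esub> v j})"
    by (simp add: adjacency_matrix_def sum.If_cases)
  also have "card {j. v i \<rightarrow>\<^bsub>G\<^esub> v j} = card (v ` {j. v i \<rightarrow>\<^bsub>G\<^esub> v j})"
    using v by (intro card_image[symmetric]) (auto simp: bij_betw_def intro: inj_on_subset)
  also have "v ` {j. v i \<rightarrow>\<^bsub>G\<^esub> v j} = head G ` out_arcs G (v i)"
  proof (intro equalityI subsetI)
    fix u assume "u \<in> head G ` out_arcs G (v i)"
    then have "v i \<rightarrow>\<^bsub>G\<^esub> u" "u \<in> verts G"
      by (auto simp: arcs_ends_conv intro: rev_image_eqI)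
    then show "u \<in> v ` {j. v i \<rightarrow>\<^bsub>G\<^esub> v j}"
      using v by (auto simp: bij_betw_def)
  qed (auto simp: arcs_ends_conv)
  also have "card \<dots> = out_degree G (v i)"
    unfolding out_degree_def
    \<comment> \<open>Without parallel arcs, an arc leaving \<open>v i\<close> is determined by its
      head.\<close>
    by (intro card_image inj_onI no_multi_arcs) (auto simp: arc_to_ends_def)
  finally show ?thesis .
qed

theorem theorem3p6:
  fixes G :: "('a, 'b) pre_digraph" and v :: "'n::finite \<Rightarrow> 'a" and i :: 'n
  assumes "graph G"
    and "arcs G \<noteq> {}"
    and "bij_betw v UNIV (verts G)"
  shows "vertex_energy G v i \<ge> sqrt (real (out_degree G (v i)) / real (max_degree G))"
proof -
  interpret graph G by (rule assms(1))
  define A where "A = adjacency_matrix G v"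
  note row = adjacency_matrix_row_sum[OF assms(1,3), folded A_def]
  \<comment> \<open>Symmetry turns the column sums into row sums, that is, into degrees.\<close>
  have "A $ k $ j = A $ j $ k" for k j
    using arcs_ends_symmetric[OF sym_arcs] by (auto simp: A_def adjacency_matrix_def)
  then have "(\<Sum>k\<in>UNIV. A $ k $ j) = real (out_degree G (v j))" for j
    using row[of j] by simp
  moreover have "out_degree G (v j) \<le> max_degree G" for j
    unfolding max_degree_def using assms(3) by (intro Max_ge) (auto simp: bij_betw_def)
  ultimately have "(\<Sum>k\<in>UNIV. A $ k $ j) \<le> real (max_degree G)" for j
    by simp
  moreover have "A $ k $ j \<in> {0, 1}" for k j
    by (simp add: A_def adjacency_matrix_def)
  ultimately show ?thesis
    unfolding vertex_energy_def row[symmetric] A_def[symmetric]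
    by (intro matrix_abs_diagonal_ge)
qed

end
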